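(* Let $n\ge 1$, let $\alpha_1,\dots,\alpha_n$ be any real numbers, and let $X_1,\dots,X_n$ be any (possibly correlated) random variables with $\mathrm{Var}(X_i)<+\infty$ for $i=1,\dots,n$. Then for any $\delta>0$, $$P\Big(\Big|\sum_{i=1}^n\alpha_iX_i-\sum_{i=1}^n\alpha_iE X_i\Big|>\delta\Big)\le\frac{\sum_{i=1}^n|\alpha_i|}{\delta^2}\sum_{i=1}^n|\alpha_i|\,\mathrm{Var}(X_i).$$
   Context: Random variables are real-valued, defined on a common probability space with probability $P$, with finite expectation and variance. "Correlated" only means that no independence or uncorrelatedness is assumed. $E$ and $\mathrm{Var}$ denote expectation and variance. *)

theory Defs
  imports "HOL-Probability.Probability"
begin

end

theory Submission
  imports Defs
begin

text \<open>
  The weighted Cauchy--Schwarz inequality, applied pointwise, bounds the square of the centred sum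
  by a combination of the individual squared deviations; this needs no information on
  the joint distribution. Markov's inequality for that upper bound gives the claim.
\<close>

text \<open>Splitting each coefficient as \<open>sqrt \<bar>a i\<bar>\<close> times
  \<open>sgn (a i) * sqrt \<bar>a i\<bar>\<close> lets the ordinary Cauchy-Schwarz inequality leave
  the weight \<open>\<bar>a i\<bar>\<close> in both factors.\<close>

lemma weighted_Cauchy_Schwarz_sum:
  fixes a y :: "'i \<Rightarrow> real"
  shows "(\<Sum>i\<in>I. a i * y i)\<^sup>2 \<le> (\<Sum>i\<in>I. \<bar>a i\<bar>) * (\<Sum>i\<in>I. \<bar>a i\<bar> * (y i)\<^sup>2)"
proof -
  have "(\<Sum>i\<in>I. a i * y i) = (\<Sum>i\<in>I. sqrt \<bar>a i\<bar> * (sgn (a i) * sqrt \<bar>a i\<bar> * y i))"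
  proof (rule sum.cong)
    fix i
    have "sqrt \<bar>a i\<bar> * (sgn (a i) * sqrt \<bar>a i\<bar> * y i) = sgn (a i) * (sqrt \<bar>a i\<bar>)\<^sup>2 * y i"
      by (simp add: power2_eq_square)
    also have "\<dots> = a i * y i"
      by (simp add: sgn_mult_abs)
    finally show "a i * y i = sqrt \<bar>a i\<bar> * (sgn (a i) * sqrt \<bar>a i\<bar> * y i)"
      by (rule sym)
  qed simp
  also have "\<dots>\<^sup>2 \<le> (\<Sum>i\<in>I. (sqrt \<bar>a i\<bar>)\<^sup>2) * (\<Sum>i\<in>I. (sgn (a i) * sqrt \<bar>a i\<bar> * y i)\<^sup>2)"
    by (rule Cauchy_Schwarz_ineq_sum)
  \<comment> \<open>The squared sign is 1 unless \<open>a i = 0\<close>, and then both summands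
    vanish.\<close>
  also have "(\<Sum>i\<in>I. (sgn (a i) * sqrt \<bar>a i\<bar> * y i)\<^sup>2) = (\<Sum>i\<in>I. \<bar>a i\<bar> * (y i)\<^sup>2)"
    by (rule sum.cong) (auto simp: power_mult_distrib sgn_if)
  finally show ?thesis by simp
qed

theorem theorem6:
  fixes M :: "'a measure" and n :: nat and \<alpha> :: "nat \<Rightarrow> real"
    and X :: "nat \<Rightarrow> 'a \<Rightarrow> real" and \<delta> :: real
  assumes "prob_space M"
    and "n \<ge> 1"
    and "\<And>i. i \<in> {1..n} \<Longrightarrow> X i \<in> borel_measurable M"
    and "\<And>i. i \<in> {1..n} \<Longrightarrow> integrable M (X i)"
    and "\<And>i. i \<in> {1..n} \<Longrightarrow>
           integrable M (\<lambda>\<omega>. (X i \<omega> - prob_space.expectation M (X i))\<^sup>2)"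
    and "\<delta> > 0"
  shows "prob_space.prob M
           {\<omega> \<in> space M.
              \<bar>(\<Sum>i=1..n. \<alpha> i * X i \<omega>)
                - (\<Sum>i=1..n. \<alpha> i * prob_space.expectation M (X i))\<bar> > \<delta>}
         \<le> (\<Sum>i=1..n. \<bar>\<alpha> i\<bar>) / \<delta>\<^sup>2
             * (\<Sum>i=1..n. \<bar>\<alpha> i\<bar> * prob_space.variance M (X i))"
proof -
  interpret prob_space M by fact
  define A where "A = (\<Sum>i=1..n. \<bar>\<alpha> i\<bar>)"
  define Y where "Y i \<omega> = X i \<omega> - expectation (X i)" for i \<omega>
  \<comment> \<open>Only squares of single deviations occur in \<open>g\<close>, so its expectation
    involves variances but no covariances.\<close>
  define g where "g \<omega> = A * (\<Sum>i=1..n. \<bar>\<alpha> i\<bar> * (Y i \<omega>)\<^sup>2)" for \<omega>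
  have int_Y: "integrable M (\<lambda>\<omega>. (Y i \<omega>)\<^sup>2)" if "i \<in> {1..n}" for i
    using assms(5)[OF that] by (simp add: Y_def)
  have int_g: "integrable M g"
    unfolding g_def by (intro integrable_mult_right Bochner_Integration.integrable_sum int_Y)
  have g_nonneg: "0 \<le> g \<omega>" for \<omega>
    unfolding g_def A_def by (intro mult_nonneg_nonneg sum_nonneg) auto
  have g_ge: "\<delta>\<^sup>2 \<le> g \<omega>"
    if "\<bar>(\<Sum>i=1..n. \<alpha> i * X i \<omega>) - (\<Sum>i=1..n. \<alpha> i * expectation (X i))\<bar> > \<delta>" for \<omega>
  proof -
    have "(\<Sum>i=1..n. \<alpha> i * X i \<omega>) - (\<Sum>i=1..n. \<alpha> i * expectation (X i))
        = (\<Sum>i=1..n. \<alpha> i * Y i \<omega>)"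
      by (simp add: Y_def right_diff_distrib sum_subtractf)
    \<comment> \<open>Positivity gives \<open>\<bar>\<delta>\<bar> = \<delta>\<close>, so comparing
      absolute values is the same as comparing squares.\<close>
    then have "\<delta>\<^sup>2 \<le> (\<Sum>i=1..n. \<alpha> i * Y i \<omega>)\<^sup>2"
      using that \<open>\<delta> > 0\<close> by (simp add: abs_le_square_iff[symmetric])
    also have "\<dots> \<le> g \<omega>"
      unfolding g_def A_def by (rule weighted_Cauchy_Schwarz_sum)
    finally show ?thesis .
  qed
  have "prob {\<omega> \<in> space M. \<bar>(\<Sum>i=1..n. \<alpha> i * X i \<omega>)
            - (\<Sum>i=1..n. \<alpha> i * expectation (X i))\<bar> > \<delta>}
      \<le> prob {\<omega> \<in> space M. g \<omega> \<ge> \<delta>\<^sup>2}"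
    \<comment> \<open>Monotonicity asks for measurability of the larger event, which integrability
      of \<open>g\<close> supplies.\<close>
    using g_ge int_g by (intro finite_measure_mono) auto
  \<comment> \<open>Markov at threshold \<open>\<delta>\<^sup>2\<close>. The \<open>A\<close>
    instantiated here is a set variable of the library rule, not the sum of weights defined
    above.\<close>
  also have "\<dots> \<le> expectation g / \<delta>\<^sup>2"
    using int_g g_nonneg \<open>\<delta> > 0\<close> by (intro integral_Markov_inequality_measure[where A = "{}"]) auto
  \<comment> \<open>Linearity of the integral applies because each squared deviation is integrable;
    its expectation is the variance by definition.\<close>
  also have "expectation g = A * (\<Sum>i=1..n. \<bar>\<alpha> i\<bar> * variance (X i))"
    unfolding g_def using int_Y by (simp add: Bochner_Integration.integral_sum Y_def)
  finally show ?thesis by (simp add: A_def)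
qed

end
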